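(* Let $0<\alpha<1$ be irrational and let $F=\{0,\alpha,1\}$. Then there is a Steinhaus set for $F$ in $\mathbb{R}$. However, there is no Steinhaus set for $F$ in $\mathbb{R}$ which is Lebesgue measurable, and there is no Steinhaus set for $F$ in $\mathbb{R}$ which has the Baire property.
   Context: For $X\subseteq\mathbb{R}$, an isometric copy of $X$ in $\mathbb{R}$ is the image of $X$ under an isometry of $\mathbb{R}$ (a set $c+X$ or $c-X$ with $c\in\mathbb{R}$). A set $S\subseteq\mathbb{R}$ is a Steinhaus set for $X$ in $\mathbb{R}$ if $|Y\cap S|=1$ for every isometric copy $Y$ of $X$ in $\mathbb{R}$. *)

theory Defs
  imports "HOL-Analysis.Analysis"
begin

definition is_isometry :: "('a::metric_space \<Rightarrow> 'a) \<Rightarrow> bool" where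
  "is_isometry f \<longleftrightarrow> surj f \<and> (\<forall>x y. dist (f x) (f y) = dist x y)"

definition isometric_copy :: "'a::metric_space set \<Rightarrow> 'a set \<Rightarrow> bool" where
  "isometric_copy X Y \<longleftrightarrow> (\<exists>f. is_isometry f \<and> Y = f ` X)"

text \<open>As \<open>card\<close> is 0 on infinite sets, \<open>card (Y \<inter> S) = 1\<close> does say that \<open>Y \<inter> S\<close> is a singleton.\<close>

definition steinhaus_set :: "'a::metric_space set \<Rightarrow> 'a set \<Rightarrow> bool" where
  "steinhaus_set X S \<longleftrightarrow> (\<forall>Y. isometric_copy X Y \<longrightarrow> card (Y \<inter> S) = 1)"

definition nowhere_dense :: "'a::topological_space set \<Rightarrow> bool" where
  "nowhere_dense A \<longleftrightarrow> interior (closure A) = {}"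

definition meager :: "'a::topological_space set \<Rightarrow> bool" where
  "meager A \<longleftrightarrow> (\<exists>\<N>. countable \<N> \<and> (\<forall>N\<in>\<N>. nowhere_dense N) \<and> A = \<Union>\<N>)"

definition has_Baire_property :: "'a::topological_space set \<Rightarrow> bool" where
  "has_Baire_property A \<longleftrightarrow> (\<exists>U. open U \<and> meager ((A - U) \<union> (U - A)))"

lemma is_isometry_real_iff:
  fixes f :: "real \<Rightarrow> real"
  shows "is_isometry f \<longleftrightarrow> (\<exists>c. f = (\<lambda>x. c + x) \<or> f = (\<lambda>x. c - x))"
proof
  assume "is_isometry f"
  then have d: "\<bar>f x - f y\<bar> = \<bar>x - y\<bar>" for x y
    by (simp add: is_isometry_def dist_real_def)
  show "\<exists>c. f = (\<lambda>x. c + x) \<or> f = (\<lambda>x. c - x)"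
  proof (cases "f 1 = f 0 + 1")
    case True
    have "f x = f 0 + x" for x
      using d[of x 0] d[of x 1] True by linarith
    then show ?thesis by blast
  next
    case False
    then have "f 1 = f 0 - 1" using d[of 1 0] by linarith
    then have "f x = f 0 - x" for x
      using d[of x 0] d[of x 1] by linarith
    then show ?thesis by blast
  qed
next
  assume "\<exists>c. f = (\<lambda>x. c + x) \<or> f = (\<lambda>x. c - x)"
  then obtain c where "f = (\<lambda>x. c + x) \<or> f = (\<lambda>x. c - x)" by blast
  then show "is_isometry f"
  proof
    assume f: "f = (\<lambda>x. c + x)"
    have "surj f" unfolding f by (rule surjI[of _ "\<lambda>y. y - c"]) simp
    then show ?thesis by (simp add: is_isometry_def f dist_real_def)
  next
    assume f: "f = (\<lambda>x. c - x)"
    have "surj f" unfolding f by (rule surjI[of _ "\<lambda>y. c - y"]) simp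
    then show ?thesis by (simp add: is_isometry_def f dist_real_def abs_minus_commute)
  qed
qed

lemma isometric_copy_real_iff:
  fixes X :: "real set"
  shows "isometric_copy X Y \<longleftrightarrow> (\<exists>c. Y = (\<lambda>x. c + x) ` X \<or> Y = (\<lambda>x. c - x) ` X)"
  unfolding isometric_copy_def is_isometry_real_iff by blast

end

theory Submission
  imports Defs
begin

text \<open>Let \<open>F = {0, \<alpha>, 1}\<close>.  The copies of \<open>F\<close> are the triples \<open>x, x + \<alpha>, x + 1\<close> and their
  mirror images \<open>x, x - \<alpha>, x - 1\<close>.  On a coset of the group \<open>\<int> + \<alpha>\<int>\<close>, which is free on \<open>1\<close>
  and \<open>\<alpha>\<close>, they are the upward and downward triangles of a triangular lattice, and a Steinhaus set
  is one colour class of a proper 3-colouring of that lattice.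

  Existence: the 3-colouring of \<open>m + n\<alpha>\<close> by \<open>m - n\<close> modulo 3 can be put on each coset separately,
  using a choice of base points (lemma \<open>ex_height\<close>).

  Nonexistence of nice Steinhaus sets: an upward and a downward triangle that share an edge have the
  same third colour, so a Steinhaus set has period \<open>1 + \<alpha>\<close>; hence \<open>x - 1\<close>, \<open>x\<close>, \<open>x + 1\<close> hold
  exactly one point of the set, and \<open>3\<close> is a period as well.  The group generated by \<open>3\<close> and
  \<open>1 + \<alpha>\<close> is dense, and translation by \<open>1\<close> makes the set disjoint from itself.  So there are
  arbitrarily small \<open>t\<close> for which \<open>S\<close> and \<open>S + t\<close> are disjoint (lemma
  \<open>steinhaus_small_disjoint_translate\<close>).  On the other hand three translates of \<open>S\<close> cover the line,
  so \<open>S\<close> is neither null nor meager.  A measurable nonnull set, and equally a nonmeager set with the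
  Baire property, meets all its sufficiently small translates (the theorems of Steinhaus and
  Piccard), a contradiction.\<close>

section \<open>Small translates of large sets\<close>

text \<open>Steinhaus' theorem.  A compact \<open>K \<subseteq> S\<close> of positive measure has an open neighbourhood \<open>U\<close>
  of less than twice its measure; a small translate of \<open>K\<close> still lies in \<open>U\<close>, and there is no room
  in \<open>U\<close> for two disjoint copies of \<open>K\<close>.\<close>

lemma lebesgue_meets_small_translates:
  fixes S :: "'a::euclidean_space set"
  assumes S: "S \<in> sets lebesgue" and pos: "\<not> negligible S"
  obtains \<delta> where "\<delta> > 0" "\<And>t. norm t < \<delta> \<Longrightarrow> \<exists>x\<in>S. x + t \<in> S"
proof -
  obtain a b where "\<not> negligible (S \<inter> cbox a b)"
    using pos negligible_on_intervals[of S] by blast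
  moreover define B where "B = S \<inter> cbox a b"
  ultimately have Bpos: "\<not> negligible B" by simp
  have B: "B \<in> lmeasurable"
    unfolding B_def using fmeasurable_Int_fmeasurable[OF lmeasurable_cbox S] by (simp add: Int_commute)
  have Bm: "measure lebesgue B > 0"
    using B Bpos negligible_iff_measure zero_less_measure_iff by blast
  obtain K where K: "closed K" "K \<subseteq> B" "B - K \<in> lmeasurable"
      "emeasure lebesgue (B - K) < ennreal (measure lebesgue B)"
    using sets_lebesgue_inner_closed[OF fmeasurableD[OF B] Bm] .
  have "bounded K"
    using K(2) unfolding B_def by (meson bounded_cbox bounded_subset le_infE)
  with K(1) have "compact K" by (simp add: compact_eq_bounded_closed)
  then have Kl: "K \<in> lmeasurable" by (rule lmeasurable_compact)
  have "measure lebesgue (B - K) < measure lebesgue B"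
    using K(3,4) by (metis Bm emeasure_eq_measure2 ennreal_less_iff measure_nonneg)
  then have Km: "measure lebesgue K > 0"
    using measurable_measure_Diff[OF B fmeasurableD[OF Kl] K(2)] by simp
  obtain U where U: "open U" "K \<subseteq> U" "U - K \<in> lmeasurable"
      "emeasure lebesgue (U - K) < ennreal (measure lebesgue K)"
    using sets_lebesgue_outer_open[OF fmeasurableD[OF Kl] Km] .
  have Ul: "U \<in> lmeasurable"
    using fmeasurable.Un[OF U(3) Kl] U(2) by (simp add: Un_absorb2)
  have "measure lebesgue (U - K) < measure lebesgue K"
    using U(3,4) by (metis emeasure_eq_measure2 ennreal_less_iff measure_nonneg)
  then have Um: "measure lebesgue U < 2 * measure lebesgue K"
    using measurable_measure_Diff[OF Ul fmeasurableD[OF Kl] U(2)] by simp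
  obtain \<delta> where \<delta>: "\<delta> > 0" "(\<Union>x\<in>K. ball x \<delta>) \<subseteq> U"
    using compact_subset_open_imp_ball_epsilon_subset[OF \<open>compact K\<close> U(1,2)] .
  show thesis
  proof
    fix t :: 'a
    assume t: "norm t < \<delta>"
    have tK: "(+) t ` K \<subseteq> U"
    proof
      fix y assume "y \<in> (+) t ` K"
      then obtain x where "x \<in> K" "y = t + x" by blast
      then have "y \<in> ball x \<delta>" using t by (simp add: dist_norm)
      with \<open>x \<in> K\<close> \<delta>(2) show "y \<in> U" by blast
    qed
    have tKl: "(+) t ` K \<in> lmeasurable"
      using Kl by (rule measurable_translation)
    have "K \<inter> (+) t ` K \<noteq> {}"
    proof
      assume "K \<inter> (+) t ` K = {}"
      then have "measure lebesgue (K \<union> (+) t ` K) = 2 * measure lebesgue K"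
        using Kl tKl by (simp add: measure_Un3 measure_translation)
      moreover have "measure lebesgue (K \<union> (+) t ` K) \<le> measure lebesgue U"
        using U(2) tK Ul Kl tKl by (intro measure_mono_fmeasurable) auto
      ultimately show False using Um by simp
    qed
    then obtain x where "x \<in> K" "t + x \<in> K" by blast
    with K(2) show "\<exists>x\<in>S. x + t \<in> S"
      unfolding B_def by (intro bexI[of _ x]) (auto simp: add.commute)
  qed (rule \<delta>(1))
qed

lemma meager_subset:
  assumes "meager A" "B \<subseteq> A"
  shows "meager B"
proof -
  obtain \<N> where N: "countable \<N>" "\<forall>N\<in>\<N>. nowhere_dense N" "A = \<Union>\<N>"
    using assms(1) unfolding meager_def by blast
  have "nowhere_dense (N \<inter> B)" if "N \<in> \<N>" for N
    using N(2) that unfolding nowhere_dense_def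
    by (metis closure_mono inf_le1 interior_mono subset_empty)
  with N assms(2) show ?thesis
    unfolding meager_def by (intro exI[of _ "(\<lambda>N. N \<inter> B) ` \<N>"]) auto
qed

lemma meager_Un:
  assumes "meager A" "meager B"
  shows "meager (A \<union> B)"
proof -
  obtain M N where "countable M" "\<forall>X\<in>M. nowhere_dense X" "A = \<Union>M"
    "countable N" "\<forall>X\<in>N. nowhere_dense X" "B = \<Union>N"
    using assms unfolding meager_def by auto
  then show ?thesis
    unfolding meager_def by (intro exI[of _ "M \<union> N"]) auto
qed

lemma meager_translation:
  fixes A :: "'a::real_normed_vector set"
  assumes "meager A"
  shows "meager ((+) c ` A)"
proof -
  obtain \<N> where N: "countable \<N>" "\<forall>N\<in>\<N>. nowhere_dense N" "A = \<Union>\<N>"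
    using assms unfolding meager_def by blast
  have "nowhere_dense ((+) c ` N)" if "N \<in> \<N>" for N
    using N(2) that unfolding nowhere_dense_def
    by (simp add: closure_translation interior_translation)
  with N show ?thesis
    unfolding meager_def by (intro exI[of _ "(`) ((+) c) ` \<N>"]) auto
qed

lemma open_meager_empty:
  fixes U :: "'a::euclidean_space set"
  assumes "open U" "meager U"
  shows "U = {}"
proof -
  obtain \<N> where N: "countable \<N>" "\<forall>N\<in>\<N>. nowhere_dense N" "U = \<Union>\<N>"
    using assms(2) unfolding meager_def by blast
  define \<G> where "\<G> = (\<lambda>N. - closure N) ` \<N>"
  have "UNIV \<subseteq> closure (\<Inter>\<G>)"
  proof (rule Baire)
    show "countable \<G>" unfolding \<G>_def using N(1) by blast
    show "openin (top_of_set UNIV) T \<and> UNIV \<subseteq> closure T" if "T \<in> \<G>" for T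
      using that N(2) unfolding \<G>_def nowhere_dense_def
      by (auto simp: closure_complement)
  qed auto
  moreover have "U \<inter> \<Inter>\<G> = {}"
    unfolding \<G>_def N(3) using closure_subset by fastforce
  ultimately show ?thesis
    using open_Int_closure_eq_empty[OF assms(1), of "\<Inter>\<G>"] by (simp add: top_unique)
qed

text \<open>Piccard's theorem, the category analogue.  Modulo a meager set \<open>S\<close> is a nonempty open set
  \<open>U\<close>, so a point common to \<open>S\<close> and \<open>S - t\<close> exists as soon as \<open>U\<close> and \<open>U - t\<close> overlap, the
  overlap being open and therefore nonmeager.\<close>

lemma Baire_property_meets_small_translates:
  fixes S :: "'a::euclidean_space set"
  assumes "has_Baire_property S" and "\<not> meager S"
  obtains \<delta> where "\<delta> > 0" "\<And>t. norm t < \<delta> \<Longrightarrow> \<exists>x\<in>S. x + t \<in> S"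
proof -
  obtain U where U: "open U" "meager ((S - U) \<union> (U - S))"
    using assms(1) unfolding has_Baire_property_def by blast
  have "U \<noteq> {}"
    using assms(2) U(2) by auto
  then obtain p where "p \<in> U" by blast
  then obtain \<delta> where \<delta>: "\<delta> > 0" "ball p \<delta> \<subseteq> U"
    using U(1) open_contains_ball by blast
  have US: "meager (U - S)"
    using U(2) by (rule meager_subset) blast
  show thesis
  proof
    fix t :: 'a
    assume t: "norm t < \<delta>"
    define V where "V = U \<inter> (+) (- t) ` U"
    have "open V"
      unfolding V_def using U(1) by (intro open_Int open_translation)
    have "p + t \<in> U"
      using t \<delta>(2) by (auto simp: dist_norm)
    with \<open>p \<in> U\<close> have "p \<in> V"
      unfolding V_def by (auto intro!: image_eqI[of _ _ "p + t"])
    with \<open>open V\<close> have "\<not> meager V"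
      using open_meager_empty by blast
    moreover have "meager ((U - S) \<union> (+) (- t) ` (U - S))"
      using US by (intro meager_Un meager_translation)
    ultimately have "\<not> V \<subseteq> (U - S) \<union> (+) (- t) ` (U - S)"
      using meager_subset by blast
    then obtain x where x: "x \<in> U" "x \<in> S" "x \<in> (+) (- t) ` U" "x \<notin> (+) (- t) ` (U - S)"
      unfolding V_def by blast
    from x(3) obtain y where "y \<in> U" "x = - t + y" by blast
    with x(4) have "x + t \<in> S" by auto
    with x(2) show "\<exists>x\<in>S. x + t \<in> S" by blast
  qed (rule \<delta>(1))
qed

section \<open>Steinhaus sets for a three-point set\<close>

lemma card_three_Int_eq_1_iff:
  assumes "a \<noteq> b" "a \<noteq> c" "b \<noteq> c"
  shows "card ({a, b, c} \<inter> S) = 1 \<longleftrightarrow>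
    of_bool (a \<in> S) + of_bool (b \<in> S) + of_bool (c \<in> S) = (1::int)"
  using assms by (simp add: Int_insert_left)

text \<open>Counting with truth values makes the relations between neighbouring triangles linear.\<close>

lemma steinhaus_set_three_iff:
  fixes \<alpha> :: real
  assumes "0 < \<alpha>" "\<alpha> < 1"
  shows "steinhaus_set {0, \<alpha>, 1} S \<longleftrightarrow>
    (\<forall>x. of_bool (x \<in> S) + of_bool (x + \<alpha> \<in> S) + of_bool (x + 1 \<in> S) = (1::int) \<and>
         of_bool (x \<in> S) + of_bool (x - \<alpha> \<in> S) + of_bool (x - 1 \<in> S) = (1::int))"
proof -
  have "steinhaus_set {0, \<alpha>, 1} S \<longleftrightarrow>
    (\<forall>x. card ({x, x + \<alpha>, x + 1} \<inter> S) = 1 \<and> card ({x, x - \<alpha>, x - 1} \<inter> S) = 1)"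
    unfolding steinhaus_set_def isometric_copy_real_iff by auto
  moreover have "card ({x, x + \<alpha>, x + 1} \<inter> S) = 1 \<longleftrightarrow>
      of_bool (x \<in> S) + of_bool (x + \<alpha> \<in> S) + of_bool (x + 1 \<in> S) = (1::int)" for x
    by (rule card_three_Int_eq_1_iff) (use assms in auto)
  moreover have "card ({x, x - \<alpha>, x - 1} \<inter> S) = 1 \<longleftrightarrow>
      of_bool (x \<in> S) + of_bool (x - \<alpha> \<in> S) + of_bool (x - 1 \<in> S) = (1::int)" for x
    by (rule card_three_Int_eq_1_iff) (use assms in auto)
  ultimately show ?thesis by (simp only:)
qed

text \<open>A function such as \<open>m + n\<alpha> \<mapsto> m - n\<close>, extended from \<open>\<int> + \<alpha>\<int>\<close> to all its cosets.
  Irrationality makes the coordinates \<open>m\<close> and \<open>n\<close> unique; the choice of a base point in each coset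
  is where the axiom of choice enters.\<close>

lemma ex_height:
  fixes \<alpha> :: real
  assumes "\<alpha> \<notin> \<rat>"
  obtains k :: "real \<Rightarrow> int" where "\<And>x. k (x + 1) = k x + 1" "\<And>x. k (x + \<alpha>) = k x - 1"
proof -
  define R where "R x y \<longleftrightarrow> (\<exists>(m::int) (n::int). x = y + m + n * \<alpha>)" for x y :: real
  have R_refl: "R x x" for x
    unfolding R_def by (intro exI[of _ 0]) simp
  have R_shift: "R (x + i + j * \<alpha>) y \<longleftrightarrow> R x y" for x y :: real and i j :: int
  proof
    assume "R (x + i + j * \<alpha>) y"
    then obtain m n :: int where "x + i + j * \<alpha> = y + m + n * \<alpha>" unfolding R_def by blast
    then have "x = y + of_int (m - i) + of_int (n - j) * \<alpha>" by (simp add: algebra_simps)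
    then show "R x y" unfolding R_def by blast
  next
    assume "R x y"
    then obtain m n :: int where "x = y + m + n * \<alpha>" unfolding R_def by blast
    then have "x + i + j * \<alpha> = y + of_int (m + i) + of_int (n + j) * \<alpha>"
      by (simp add: algebra_simps)
    then show "R (x + i + j * \<alpha>) y" unfolding R_def by blast
  qed
  define base where "base x = (SOME y. R x y)" for x
  have base_shift: "base (x + of_int i + of_int j * \<alpha>) = base x" for x i j
    unfolding base_def R_shift ..
  have "R x (base x)" for x
    unfolding base_def using R_refl by (rule someI)
  then have "\<exists>(m::int) (n::int). x = base x + m + n * \<alpha>" for x
    unfolding R_def .
  then obtain m n :: "real \<Rightarrow> int" where mn: "\<And>x. x = base x + m x + n x * \<alpha>"
    by metis
  have shift: "m (x + of_int i + of_int j * \<alpha>) = m x + i \<and>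
               n (x + of_int i + of_int j * \<alpha>) = n x + j" for x i j
  proof -
    let ?y = "x + of_int i + of_int j * \<alpha>"
    define p q where "p = m x + i - m ?y" and "q = n ?y - n x - j"
    have eq: "of_int p = of_int q * \<alpha>"
      using mn[of x] mn[of ?y] unfolding base_shift p_def q_def by (simp add: algebra_simps)
    have "q = 0"
    proof (rule ccontr)
      assume "q \<noteq> 0"
      with eq have "\<alpha> = of_int p / of_int q" by (simp add: field_simps)
      with assms show False by simp
    qed
    with eq show ?thesis unfolding p_def q_def by simp
  qed
  show thesis
  proof
    fix x
    show "m (x + 1) - n (x + 1) = m x - n x + 1"
      using shift[of x 1 0] by simp
    show "m (x + \<alpha>) - n (x + \<alpha>) = m x - n x - 1"
      using shift[of x 0 1] by simp
  qed
qed

lemma ex_steinhaus_set_three: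
  fixes \<alpha> :: real
  assumes "0 < \<alpha>" "\<alpha> < 1" "\<alpha> \<notin> \<rat>"
  shows "\<exists>S. steinhaus_set {0, \<alpha>, 1} S"
proof -
  obtain k :: "real \<Rightarrow> int" where k: "\<And>x. k (x + 1) = k x + 1" "\<And>x. k (x + \<alpha>) = k x - 1"
    using ex_height[OF assms(3)] by blast
  have k': "k (x - 1) = k x - 1" "k (x - \<alpha>) = k x + 1" for x
    using k(1)[of "x - 1"] k(2)[of "x - \<alpha>"] by simp_all
  \<comment> \<open>The three points of any copy have heights \<open>j - 1\<close>, \<open>j\<close> and \<open>j + 1\<close> for some \<open>j\<close>.\<close>
  have one: "of_bool (3 dvd j) + of_bool (3 dvd j - 1) + of_bool (3 dvd j + 1) = (1::int)" for j :: int
  proof -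
    have "3 dvd j \<and> \<not> 3 dvd j - 1 \<and> \<not> 3 dvd j + 1 \<or>
          \<not> 3 dvd j \<and> 3 dvd j - 1 \<and> \<not> 3 dvd j + 1 \<or>
          \<not> 3 dvd j \<and> \<not> 3 dvd j - 1 \<and> 3 dvd j + 1"
      by presburger
    then show ?thesis by auto
  qed
  have "steinhaus_set {0, \<alpha>, 1} {x. 3 dvd k x}"
    unfolding steinhaus_set_three_iff[OF assms(1,2)] mem_Collect_eq k k'
  proof (intro allI conjI)
    fix x
    show "of_bool (3 dvd k x) + of_bool (3 dvd k x - 1) + of_bool (3 dvd k x + 1) = (1::int)"
      by (rule one)
    show "of_bool (3 dvd k x) + of_bool (3 dvd k x + 1) + of_bool (3 dvd k x - 1) = (1::int)"
      using one[of "k x"] by linarith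
  qed
  then show ?thesis ..
qed

text \<open>The triples \<open>x, x + \<alpha>, x + 1\<close> and \<open>x + \<alpha>, x + 1, x + 1 + \<alpha>\<close> are copies
  that share two points, which gives the period \<open>1 + \<alpha>\<close>.  Moving \<open>x + \<alpha>\<close> back by it turns the first
  triple into \<open>x - 1, x, x + 1\<close>; comparing this with \<open>x, x + 1, x + 2\<close> gives the period \<open>3\<close>.\<close>

lemma steinhaus_three_periods:
  fixes \<alpha> :: real
  assumes "0 < \<alpha>" "\<alpha> < 1" "steinhaus_set {0, \<alpha>, 1} S"
  shows "x + (1 + \<alpha>) \<in> S \<longleftrightarrow> x \<in> S" and "x + 3 \<in> S \<longleftrightarrow> x \<in> S"
proof -
  note S = assms(3)[unfolded steinhaus_set_three_iff[OF assms(1,2)], rule_format]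
  have period: "x + (1 + \<alpha>) \<in> S \<longleftrightarrow> x \<in> S" for x
  proof -
    have "x + (1 + \<alpha>) - \<alpha> = x + 1" "x + (1 + \<alpha>) - 1 = x + \<alpha>" by simp_all
    then have "of_bool (x + (1 + \<alpha>) \<in> S) = (of_bool (x \<in> S) :: int)"
      using S[of x] S[of "x + (1 + \<alpha>)"] by simp
    then show ?thesis by (simp split: if_splits add: of_bool_def)
  qed
  show "x + (1 + \<alpha>) \<in> S \<longleftrightarrow> x \<in> S" by (rule period)
  have three: "of_bool (x - 1 \<in> S) + of_bool (x \<in> S) + of_bool (x + 1 \<in> S) = (1::int)" for x
    using S[of x] period[of "x - 1"] by simp
  have "of_bool (x + 3 \<in> S) = (of_bool (x \<in> S) :: int)"
    using three[of "x + 1"] three[of "x + 2"] by (simp add: add_ac)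
  then show "x + 3 \<in> S \<longleftrightarrow> x \<in> S" by (simp split: if_splits add: of_bool_def)
qed

lemma periodic_of_int_mult:
  fixes d :: real
  assumes "\<And>x. x + d \<in> S \<longleftrightarrow> x \<in> S"
  shows "x + of_int i * d \<in> S \<longleftrightarrow> x \<in> S"
proof (induction i rule: int_induct[where k = 0])
  case (step1 i)
  then show ?case using assms[of "x + of_int i * d"] by (simp add: algebra_simps)
next
  case (step2 i)
  then show ?case using assms[of "x + of_int (i - 1) * d"] by (simp add: algebra_simps)
qed simp

text \<open>The periods are dense, so some period \<open>g\<close> is close to \<open>- 1\<close>; translation by \<open>g + 1\<close> then
  acts on \<open>S\<close> like translation by \<open>1\<close>, which maps \<open>S\<close> off itself.\<close>

lemma steinhaus_small_disjoint_translate: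
  fixes \<alpha> :: real
  assumes "0 < \<alpha>" "\<alpha> < 1" "\<alpha> \<notin> \<rat>" "steinhaus_set {0, \<alpha>, 1} S" "\<delta> > 0"
  obtains t where "\<bar>t\<bar> < \<delta>" "\<And>x. x \<in> S \<Longrightarrow> x + t \<notin> S"
proof -
  note S = assms(4)[unfolded steinhaus_set_three_iff[OF assms(1,2)], rule_format]
  have "(1 + \<alpha>) / 3 \<notin> \<rat>"
  proof
    assume "(1 + \<alpha>) / 3 \<in> \<rat>"
    then have "3 * ((1 + \<alpha>) / 3) - 1 \<in> \<rat>" by (intro Rats_diff Rats_mult) auto
    moreover have "3 * ((1 + \<alpha>) / 3) - 1 = \<alpha>" by (simp add: field_simps)
    ultimately show False using assms(3) by simp
  qed
  then obtain h k where hk: "\<bar>of_int k * ((1 + \<alpha>) / 3) - of_int h - (- 1 / 3)\<bar> < \<delta> / 3"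
    using sequence_of_fractional_parts_is_dense[of "(1 + \<alpha>) / 3" "\<delta> / 3" "- 1 / 3"] assms(5)
    by (metis divide_pos_pos zero_less_numeral)
  \<comment> \<open>Scaled by \<open>3\<close>, the approximation of \<open>- 1 / 3\<close> is one of \<open>- 1\<close> by a period.\<close>
  define g where "g = of_int k * (1 + \<alpha>) + of_int (- h) * 3"
  have "\<bar>(g + 1) / 3\<bar> < \<delta> / 3"
    using hk unfolding g_def by (simp add: field_simps)
  then have "\<bar>g + 1\<bar> < \<delta>" by simp
  moreover have "x + (g + 1) \<notin> S" if "x \<in> S" for x
  proof -
    note periods = steinhaus_three_periods[OF assms(1,2,4)]
    have "x + g \<in> S"
      using that periodic_of_int_mult[OF periods(1), of x k]
        periodic_of_int_mult[OF periods(2), of "x + of_int k * (1 + \<alpha>)" "- h"]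
      unfolding g_def add.assoc by blast
    then have "x + g + 1 \<notin> S" using S[of "x + g"] by (auto simp: of_bool_def split: if_splits)
    then show ?thesis by (simp add: add.assoc)
  qed
  ultimately show thesis using that by blast
qed

lemma steinhaus_three_cover:
  fixes \<alpha> :: real
  assumes "0 < \<alpha>" "\<alpha> < 1" "steinhaus_set {0, \<alpha>, 1} S"
  shows "UNIV = S \<union> (+) (- \<alpha>) ` S \<union> (+) (- 1) ` S"
proof (intro equalityI subsetI)
  fix x :: real
  note S = assms(3)[unfolded steinhaus_set_three_iff[OF assms(1,2)], rule_format]
  have "x \<in> S \<or> x + \<alpha> \<in> S \<or> x + 1 \<in> S"
    using S[of x] by auto
  then show "x \<in> S \<union> (+) (- \<alpha>) ` S \<union> (+) (- 1) ` S"
    by (force intro: image_eqI[of _ _ "x + \<alpha>"] image_eqI[of _ _ "x + 1"])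
qed simp

section \<open>Existence and irregularity\<close>

theorem proposition2p2:
  fixes \<alpha> :: real
  assumes "0 < \<alpha>" and "\<alpha> < 1" and "\<alpha> \<notin> \<rat>"
  shows "(\<exists>S. steinhaus_set {0, \<alpha>, 1} S)
    \<and> \<not> (\<exists>S. steinhaus_set {0, \<alpha>, 1} S \<and> S \<in> sets lebesgue)
    \<and> \<not> (\<exists>S. steinhaus_set {0, \<alpha>, 1} S \<and> has_Baire_property S)"
proof (intro conjI notI; (elim exE conjE)?)
  show "\<exists>S. steinhaus_set {0, \<alpha>, 1} S"
    using ex_steinhaus_set_three[OF assms] .
next
  fix S
  assume S: "steinhaus_set {0, \<alpha>, 1} S" and "S \<in> sets lebesgue"
  have "\<not> negligible S"
  proof
    assume "negligible S"
    then have "negligible (S \<union> (+) (- \<alpha>) ` S \<union> (+) (- 1) ` S)"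
      by (intro negligible_Un negligible_translation)
    then have "negligible (UNIV :: real set)"
      using steinhaus_three_cover[OF assms(1,2) S] by (simp only:)
    then show False by simp
  qed
  with \<open>S \<in> sets lebesgue\<close> obtain \<delta> where "\<delta> > 0" "\<And>t. norm t < \<delta> \<Longrightarrow> \<exists>x\<in>S. x + t \<in> S"
    using lebesgue_meets_small_translates by blast
  then show False
    using steinhaus_small_disjoint_translate[OF assms S] by (metis real_norm_def)
next
  fix S
  assume S: "steinhaus_set {0, \<alpha>, 1} S" and "has_Baire_property S"
  have "\<not> meager S"
  proof
    assume "meager S"
    then have "meager (S \<union> (+) (- \<alpha>) ` S \<union> (+) (- 1) ` S)"
      by (intro meager_Un meager_translation)
    then have "meager (UNIV :: real set)"
      using steinhaus_three_cover[OF assms(1,2) S] by (simp only:)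
    then show False
      using open_meager_empty[of "UNIV :: real set"] by simp
  qed
  with \<open>has_Baire_property S\<close> obtain \<delta>
    where "\<delta> > 0" "\<And>t. norm t < \<delta> \<Longrightarrow> \<exists>x\<in>S. x + t \<in> S"
    using Baire_property_meets_small_translates by blast
  then show False
    using steinhaus_small_disjoint_translate[OF assms S] by (metis real_norm_def)
qed

end
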